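(* Let $f:\mathbb{R}\to\mathbb{R}$ be a nonnegative nondecreasing function and let $G=(A\cup B,E)$ be a bipartite graph on $n$ vertices with average degree $\bar d(G)=2|E|/n\ge 16$. (i) If every pair of vertices of $G$ has $f$-sparse sub-bineighborhoods, then $(\bar d(G))^3\le 2^{11}n f(2\bar d(G))$. (ii) If every pair of adjacent vertices of $G$ has $f$-sparse sub-bineighborhoods and $|E|\ge 25n^{3/2}$, then $(\bar d(G))^3\le 2^{20} n f(2\bar d(G))$.
   Context: For a graph $G$ and vertex $v$, $N_G(v)$ denotes the set of neighbors of $v$. For disjoint vertex sets $U,V$, $G(U,V)$ is the bipartite graph with vertex set $U\cup V$ and edge set $\{uv\in E(G): u\in U, v\in V\}$. Two vertices $u,v$ of $G$ have $f$-sparse sub-bineighborhoods if for every two disjoint subsets $U\subseteq N_G(u)\setminus\{v\}$ and $V\subseteq N_G(v)\setminus\{u\}$ we have $|E(G(U,V))|\le f(|U\cup V|)$. *)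

theory Defs
  imports Complex_Main
begin

(* A graph is given by its vertex set V and its set E of edges, an edge being the
   unordered pair {u, v} of its two endpoints; hence card E counts each edge once. *)

definition finite_simple_graph :: "'a set \<Rightarrow> 'a set set \<Rightarrow> bool" where
  "finite_simple_graph V E \<longleftrightarrow> finite V \<and> (\<forall>e\<in>E. e \<subseteq> V \<and> card e = 2)"

definition bipartition :: "'a set \<Rightarrow> 'a set \<Rightarrow> 'a set set \<Rightarrow> bool" where
  "bipartition A B E \<longleftrightarrow> A \<inter> B = {} \<and> (\<forall>e\<in>E. \<exists>a\<in>A. \<exists>b\<in>B. e = {a, b})"

definition average_degree :: "'a set \<Rightarrow> 'a set set \<Rightarrow> real" where
  "average_degree V E = 2 * real (card E) / real (card V)"

definition neighbors :: "'a set set \<Rightarrow> 'a \<Rightarrow> 'a set" where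
  "neighbors E v = {w. {v, w} \<in> E}"

definition edges_between :: "'a set set \<Rightarrow> 'a set \<Rightarrow> 'a set \<Rightarrow> 'a set set" where
  "edges_between E U W = {{u, w} | u w. u \<in> U \<and> w \<in> W \<and> {u, w} \<in> E}"

definition sparse_sub_bineighborhoods ::
  "(real \<Rightarrow> real) \<Rightarrow> 'a set set \<Rightarrow> 'a \<Rightarrow> 'a \<Rightarrow> bool" where
  "sparse_sub_bineighborhoods f E u v \<longleftrightarrow>
    (\<forall>U W. U \<subseteq> neighbors E u - {v} \<longrightarrow> W \<subseteq> neighbors E v - {u} \<longrightarrow> U \<inter> W = {} \<longrightarrow>
      real (card (edges_between E U W)) \<le> f (real (card (U \<union> W))))"

end

theory Submission
  imports Defs "HOL-Analysis.Convex"
begin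

text \<open>
  Split every vertex into copies whose neighbourhoods partition the original one into blocks of
  size at most \<open>m = \<lfloor>d\<rfloor>\<close>. This keeps the number of edges and at most about doubles the number of
  vertices, and the sparsity hypothesis now bounds by \<open>f (2 * d)\<close> the number of paths of length
  three joining two copies. For (i), at least a constant fraction of the edges have both ends of
  degree at least \<open>d / 8\<close>, so there are of the order of \<open>n * d ^ 3\<close> such paths, shared by at most
  about \<open>n\<^sup>2\<close> pairs of ends. For (ii), only the paths with adjacent ends matter, i.e. the 4-cycles:
  there are of the order of \<open>d ^ 4\<close> closed walks of length four by Cauchy-Schwarz, of which at most
  \<open>n * d\<^sup>2\<close> are degenerate, and the rest are shared by the \<open>n * d / 2\<close> edges.
\<close>

section \<open>Splitting vertices into copies of bounded degree\<close>

text \<open>Enumerate \<open>S\<close> and cut the enumeration into consecutive runs of length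
  \<open>m\<close>: the label is the quotient of the index by \<open>m\<close>. At most one more
  than \<open>card S div m\<close> labels occur; multiplying by \<open>m\<close> keeps the bound
  free of division and produces the extra \<open>m\<close>.\<close>

lemma balanced_labelling:
  assumes "finite S" "m > 0"
  shows "\<exists>c :: 'a \<Rightarrow> nat. (\<forall>k. card {x\<in>S. c x = k} \<le> m) \<and> m * card (c ` S) \<le> m + card S"
proof -
  obtain h where h: "bij_betw h S {0..<card S}"
    using ex_bij_betw_finite_nat[OF assms(1)] by blast
  define c where "c x = h x div m" for x
  have "card {x\<in>S. c x = k} \<le> m" for k
  proof -
    have "h ` {x\<in>S. c x = k} \<subseteq> {k * m..<k * m + m}"
      using div_times_less_eq_dividend[of _ m] dividend_less_div_times[OF assms(2)]
      by (auto simp: c_def add.commute)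
    moreover have "inj_on h {x\<in>S. c x = k}"
      using h by (auto simp: bij_betw_def inj_on_def)
    ultimately have "card {x\<in>S. c x = k} \<le> card {k * m..<k * m + m}"
      by (metis card_inj_on_le finite_atLeastLessThan)
    then show ?thesis by simp
  qed
  moreover have "h x \<le> card S" if "x \<in> S" for x
    using bij_betwE[OF h] that less_imp_le by auto
  then have "c ` S \<subseteq> {..card S div m}"
    by (auto simp: c_def intro: div_le_mono)
  then have "card (c ` S) \<le> Suc (card S div m)"
    by (metis card_atMost card_mono finite_atMost)
  then have "m * card (c ` S) \<le> m * Suc (card S div m)"
    by (rule mult_le_mono2)
  then have "m * card (c ` S) \<le> m + card S"
    using times_div_less_eq_dividend[of m "card S"] unfolding mult_Suc_right by linarith
  ultimately show ?thesis by blast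
qed

lemma card_eq_sum_out_degrees:
  assumes "finite X"
  shows "card X = (\<Sum>a\<in>Domain X. card (X `` {a}))"
proof -
  have "X = Sigma (Domain X) (\<lambda>a. X `` {a})" by auto
  then show ?thesis
    using card_SigmaI[of "Domain X" "\<lambda>a. X `` {a}"] assms finite_Domain[OF assms]
    by (metis (no_types, lifting) finite_Image)
qed

text \<open>Each \<open>a\<close> labels its own neighbourhood in balanced blocks, and
  \<open>(a, c a b)\<close> is the copy of \<open>a\<close> that will receive the edge
  \<open>(a, b)\<close>. Every vertex costs one possibly incomplete block, and the degrees add up to
  \<open>card X\<close>.\<close>

lemma one_sided_labelling:
  assumes "finite X" "m > 0"
  shows "\<exists>c :: 'a \<Rightarrow> 'b \<Rightarrow> nat. (\<forall>a k. card {b. (a, b) \<in> X \<and> c a b = k} \<le> m) \<and>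
           m * card ((\<lambda>(a, b). (a, c a b)) ` X) \<le> m * card (Domain X) + card X"
proof -
  have "\<forall>a. \<exists>c :: 'b \<Rightarrow> nat. (\<forall>k. card {x\<in>X `` {a}. c x = k} \<le> m) \<and>
           m * card (c ` (X `` {a})) \<le> m + card (X `` {a})"
    using balanced_labelling[OF finite_Image[OF assms(1)] assms(2)] by blast
  then obtain c :: "'a \<Rightarrow> 'b \<Rightarrow> nat" where
    c1: "\<And>a k. card {x\<in>X `` {a}. c a x = k} \<le> m" and
    c2: "\<And>a. m * card (c a ` (X `` {a})) \<le> m + card (X `` {a})"
    by metis
  have "(\<lambda>(a, b). (a, c a b)) ` X = Sigma (Domain X) (\<lambda>a. c a ` (X `` {a}))"
    by force
  then have "card ((\<lambda>(a, b). (a, c a b)) ` X) = (\<Sum>a\<in>Domain X. card (c a ` (X `` {a})))"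
    using assms(1) by (simp add: finite_Domain finite_Image)
  then have "m * card ((\<lambda>(a, b). (a, c a b)) ` X) = (\<Sum>a\<in>Domain X. m * card (c a ` (X `` {a})))"
    by (simp add: sum_distrib_left)
  also have "\<dots> \<le> (\<Sum>a\<in>Domain X. m + card (X `` {a}))"
    by (rule sum_mono) (rule c2)
  also have "\<dots> = m * card (Domain X) + card X"
    by (simp add: sum.distrib card_eq_sum_out_degrees[OF assms(1)])
  finally show ?thesis using c1 by (intro exI[of _ c]) auto
qed

text \<open>Splitting the vertices of a bipartite graph \<open>X\<close> into copies of degree at most \<open>m\<close>; the
  first components of the vertices of \<open>R\<close> are the vertices they are copies of.\<close>

lemma vertex_splitting:
  fixes X :: "('a \<times> 'b) set"
  assumes "finite X" "m > 0"
  obtains R :: "(('a \<times> nat) \<times> ('b \<times> nat)) set" where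
    "bij_betw (map_prod fst fst) R X"
    "\<And>x. card (R `` {x}) \<le> m" "\<And>y. card (R\<inverse> `` {y}) \<le> m"
    "m * card (Domain R) \<le> m * card (Domain X) + card X"
    "m * card (Range R) \<le> m * card (Range X) + card X"
proof -
  obtain c :: "'a \<Rightarrow> 'b \<Rightarrow> nat" where
    c1: "\<And>a k. card {b. (a, b) \<in> X \<and> c a b = k} \<le> m" and
    c2: "m * card ((\<lambda>(a, b). (a, c a b)) ` X) \<le> m * card (Domain X) + card X"
    using one_sided_labelling[OF assms] by blast
  have "finite (X\<inverse>)" using assms(1) by simp
  from one_sided_labelling[OF this assms(2)]
  obtain c' :: "'b \<Rightarrow> 'a \<Rightarrow> nat" where
    d1: "\<And>b k. card {a. (b, a) \<in> X\<inverse> \<and> c' b a = k} \<le> m" and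
    d2: "m * card ((\<lambda>(b, a). (b, c' b a)) ` (X\<inverse>)) \<le> m * card (Domain (X\<inverse>)) + card (X\<inverse>)"
    by blast
  \<comment> \<open>Each edge is attached to one copy at either end, chosen by that end's labelling.
    It therefore survives exactly once, and forgetting the labels recovers it.\<close>
  define R where "R = (\<lambda>(a, b). ((a, c a b), (b, c' b a))) ` X"
  have "bij_betw (map_prod fst fst) R X"
    unfolding bij_betw_def R_def by (auto simp: inj_on_def image_iff split: prod.splits) force
  moreover have "card (R `` {x}) \<le> m" for x
  proof -
    \<comment> \<open>The neighbours of a copy come from a single block, and each vertex of the
      block contributes only one of its copies.\<close>
    have "R `` {x} \<subseteq> (\<lambda>b. (b, c' b (fst x))) ` {b. (fst x, b) \<in> X \<and> c (fst x) b = snd x}"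
      by (auto simp: R_def)
    moreover have "finite {b. (fst x, b) \<in> X \<and> c (fst x) b = snd x}"
      by (rule finite_subset[of _ "Range X"]) (use assms(1) in \<open>auto simp: finite_Range\<close>)
    ultimately have "card (R `` {x}) \<le> card {b. (fst x, b) \<in> X \<and> c (fst x) b = snd x}"
      by (meson card_image_le card_mono finite_imageI le_trans)
    then show ?thesis using c1 le_trans by blast
  qed
  moreover have "card (R\<inverse> `` {y}) \<le> m" for y
  proof -
    have "R\<inverse> `` {y} \<subseteq> (\<lambda>a. (a, c a (fst y))) ` {a. (fst y, a) \<in> X\<inverse> \<and> c' (fst y) a = snd y}"
      by (auto simp: R_def)
    moreover have "finite {a. (fst y, a) \<in> X\<inverse> \<and> c' (fst y) a = snd y}"
      by (rule finite_subset[of _ "Domain X"]) (use assms(1) in \<open>auto simp: finite_Domain\<close>)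
    ultimately have "card (R\<inverse> `` {y}) \<le> card {a. (fst y, a) \<in> X\<inverse> \<and> c' (fst y) a = snd y}"
      by (meson card_image_le card_mono finite_imageI le_trans)
    then show ?thesis using d1 le_trans by blast
  qed
  moreover have "Domain R = (\<lambda>(a, b). (a, c a b)) ` X"
    by (force simp: R_def)
  moreover have "Range R = (\<lambda>(b, a). (b, c' b a)) ` (X\<inverse>)"
    by (force simp: R_def)
  ultimately show ?thesis
    using that[of R] c2 d2 by simp
qed

section \<open>Paths of length three and the sparsity hypothesis\<close>

text \<open>A path \<open>x\<close>, \<open>y'\<close>, \<open>x'\<close>, \<open>y\<close> with
  given ends is recorded by its middle edge. The ends need not be adjacent; if they are, the edge
  \<open>(x, y)\<close> closes the path to a 4-cycle.\<close>

definition path_middles :: "('x \<times> 'y) set \<Rightarrow> 'x \<Rightarrow> 'y \<Rightarrow> ('x \<times> 'y) set" where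
  "path_middles R x y = {(x', y') \<in> R. (x, y') \<in> R \<and> (x', y) \<in> R \<and> x' \<noteq> x \<and> y' \<noteq> y}"

text \<open>Forgetting labels maps the middle edges injectively to edges of the original graph
  between \<open>U\<close> and \<open>W\<close>, the originals of the neighbours of \<open>x\<close>
  and of \<open>y\<close>. Splitting has reduced these sets to at most \<open>m\<close> elements
  each, which is why \<open>f\<close> is evaluated at no more than \<open>2 * d\<close>.\<close>

lemma path_middles_le_sparse:
  fixes E :: "'a set set" and R :: "(('a \<times> nat) \<times> ('a \<times> nat)) set"
  assumes f: "mono (f :: real \<Rightarrow> real)"
    and disj: "A \<inter> B = {}"
    and inj: "inj_on (map_prod fst fst) R"
    and edges: "\<And>x y. (x, y) \<in> R \<Longrightarrow> fst x \<in> A \<and> fst y \<in> B \<and> {fst x, fst y} \<in> E"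
    and fin: "finite R"
    and deg: "card (R `` {x}) \<le> m" "card (R\<inverse> `` {y}) \<le> m"
    and sparse: "sparse_sub_bineighborhoods f E (fst x) (fst y)"
    and d: "real m \<le> d"
  shows "real (card (path_middles R x y)) \<le> f (2 * d)"
proof -
  define U where "U = fst ` (R `` {x}) - {fst y}"
  define W where "W = fst ` (R\<inverse> `` {y}) - {fst x}"
  have finU: "finite (R `` {x})" "finite (R\<inverse> `` {y})"
    using fin by (auto intro: finite_Image)
  have "card U \<le> m" "card W \<le> m"
    unfolding U_def W_def using finU deg
    by (meson Diff_subset card_image_le card_mono finite_imageI le_trans)+
  then have "card (U \<union> W) \<le> 2 * m"
    using card_Un_le[of U W] by linarith
  then have size: "f (real (card (U \<union> W))) \<le> f (2 * d)"
    using d by (intro monoD[OF f]) simp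
  have UN: "U \<subseteq> neighbors E (fst x) - {fst y}"
    using edges by (fastforce simp: U_def neighbors_def)
  have WN: "W \<subseteq> neighbors E (fst y) - {fst x}"
    using edges by (fastforce simp: W_def neighbors_def insert_commute)
  have UB: "U \<subseteq> B" "W \<subseteq> A"
    using edges by (fastforce simp: U_def W_def)+
  have UW: "U \<inter> W = {}"
    using UB disj by blast
  have fin_eb: "finite (edges_between E U W)"
  proof (rule finite_subset)
    show "edges_between E U W \<subseteq> (\<lambda>(u, w). {u, w}) ` (U \<times> W)"
      by (auto simp: edges_between_def)
    show "finite ((\<lambda>(u, w). {u, w}) ` (U \<times> W))"
      using finU by (simp add: U_def W_def)
  qed
  define \<phi> :: "('a \<times> nat) \<times> ('a \<times> nat) \<Rightarrow> 'a set" where "\<phi> = (\<lambda>(x', y'). {fst y', fst x'})"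
  have "inj_on \<phi> (path_middles R x y)"
  proof (rule inj_onI)
    fix p q assume p: "p \<in> path_middles R x y" and q: "q \<in> path_middles R x y" and eq: "\<phi> p = \<phi> q"
    obtain p1 p2 q1 q2 where pq: "p = (p1, p2)" "q = (q1, q2)" by (metis surj_pair)
    have R: "p \<in> R" "q \<in> R" using p q by (auto simp: path_middles_def)
    then have "fst p1 \<in> A" "fst q1 \<in> A" "fst p2 \<in> B" "fst q2 \<in> B"
      using edges pq by auto
    \<comment> \<open>As \<open>A\<close> and \<open>B\<close> are disjoint, an unordered edge
      determines which of its ends lies in \<open>A\<close>.\<close>
    then have "fst p1 = fst q1 \<and> fst p2 = fst q2"
      using eq disj by (auto simp: \<phi>_def pq doubleton_eq_iff)
    then show "p = q"
      using inj_onD[OF inj _ R] by (simp add: pq)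
  qed
  moreover have "\<phi> ` path_middles R x y \<subseteq> edges_between E U W"
  proof
    fix e assume "e \<in> \<phi> ` path_middles R x y"
    then obtain x' y' where e: "e = {fst y', fst x'}"
      and R: "(x', y') \<in> R" "(x, y') \<in> R" "(x', y) \<in> R" and ne: "x' \<noteq> x" "y' \<noteq> y"
      by (auto simp: \<phi>_def path_middles_def)
    \<comment> \<open>Two copies of one vertex have no common neighbour in the split graph.\<close>
    have "fst y' \<noteq> fst y" using inj_onD[OF inj _ R(1,3)] ne by auto
    moreover have "fst x' \<noteq> fst x" using inj_onD[OF inj _ R(1,2)] ne by auto
    ultimately have "fst y' \<in> U" "fst x' \<in> W"
      using R by (force simp: U_def W_def)+
    moreover have "{fst y', fst x'} \<in> E"
      using edges[OF R(1)] by (simp add: insert_commute)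
    ultimately show "e \<in> edges_between E U W"
      unfolding edges_between_def e by blast
  qed
  ultimately have "card (path_middles R x y) \<le> card (edges_between E U W)"
    using card_inj_on_le fin_eb by blast
  also have "real \<dots> \<le> f (real (card (U \<union> W)))"
    using sparse UN WN UW by (simp add: sparse_sub_bineighborhoods_def)
  finally show ?thesis using size by linarith
qed

section \<open>Counting paths of length three by their middle edges\<close>

text \<open>Double counting: a path is its middle edge extended at each end by a further neighbour.
  The truncated subtractions are exact, since both ends of an edge of \<open>R\<close> have degree
  at least one.\<close>

lemma sum_path_middles:
  assumes "finite R"
  shows "(\<Sum>(x, y)\<in>Domain R \<times> Range R. card (path_middles R x y)) =
         (\<Sum>(x, y)\<in>R. (card (R\<inverse> `` {y}) - 1) * (card (R `` {x}) - 1))"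
proof -
  let ?P = "Domain R \<times> Range R"
  have finP: "finite ?P" using assms by (simp add: finite_Domain finite_Range)
  have "(\<Sum>(x, y)\<in>?P. card (path_middles R x y)) =
    (\<Sum>p\<in>?P. \<Sum>q\<in>R. if q \<in> path_middles R (fst p) (snd p) then 1 else 0)"
  proof (rule sum.cong[OF refl], clarify)
    fix x y
    have "path_middles R x y = {q\<in>R. q \<in> path_middles R x y}"
      by (auto simp: path_middles_def)
    then show "card (path_middles R x y) =
      (\<Sum>q\<in>R. if q \<in> path_middles R (fst (x, y)) (snd (x, y)) then 1 else 0)"
      using assms by (simp add: sum.If_cases Int_def)
  qed
  also have "\<dots> = (\<Sum>q\<in>R. \<Sum>p\<in>?P. if q \<in> path_middles R (fst p) (snd p) then 1 else 0)"
    by (rule sum.swap)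
  also have "\<dots> = (\<Sum>(x, y)\<in>R. (card (R\<inverse> `` {y}) - 1) * (card (R `` {x}) - 1))"
  proof (rule sum.cong[OF refl], clarify)
    fix x y assume xy: "(x, y) \<in> R"
    have "?P \<inter> {p. (x, y) \<in> path_middles R (fst p) (snd p)} =
        (R\<inverse> `` {y} - {x}) \<times> (R `` {x} - {y})"
      using xy by (auto simp: path_middles_def)
    moreover have "card (R\<inverse> `` {y} - {x}) = card (R\<inverse> `` {y}) - 1" "card (R `` {x} - {y}) = card (R `` {x}) - 1"
      using xy by (auto simp: card_Diff_singleton)
    ultimately show "(\<Sum>p\<in>?P. if (x, y) \<in> path_middles R (fst p) (snd p) then 1 else 0) =
        (card (R\<inverse> `` {y}) - 1) * (card (R `` {x}) - 1)"
      using finP by (simp add: sum.If_cases card_cartesian_product)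
  qed
  finally show ?thesis .
qed

lemma card_low_out_degree_edges:
  assumes "finite R" "t \<ge> 0"
  shows "real (card {(x, y)\<in>R. real (card (R `` {x})) < t}) \<le> t * real (card (Domain R))"
proof -
  let ?D = "{x\<in>Domain R. real (card (R `` {x})) < t}"
  have fin: "finite (Domain R)" using assms by (simp add: finite_Domain)
  have "{(x, y)\<in>R. real (card (R `` {x})) < t} = Sigma ?D (\<lambda>x. R `` {x})"
    by auto
  then have "real (card {(x, y)\<in>R. real (card (R `` {x})) < t}) = (\<Sum>x\<in>?D. real (card (R `` {x})))"
    using assms(1) fin by (simp add: finite_Image)
  also have "\<dots> \<le> (\<Sum>x\<in>?D. t)" by (rule sum_mono) auto
  also have "\<dots> \<le> (\<Sum>x\<in>Domain R. t)"
    using fin assms(2) by (intro sum_mono2) auto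
  finally show ?thesis by (simp add: mult.commute)
qed

text \<open>Discarding all edges with an end of degree below \<open>t\<close> costs at most
  \<open>t\<close> edges per vertex. Each remaining edge is the middle of at least
  \<open>(t - 1)\<^sup>2\<close> paths.\<close>

lemma sum_path_middles_ge:
  assumes "finite R" "t \<ge> 1"
  shows "(t - 1)\<^sup>2 * (real (card R) - t * (real (card (Domain R)) + real (card (Range R))))
    \<le> real (\<Sum>(x, y)\<in>Domain R \<times> Range R. card (path_middles R x y))"
proof -
  define L where "L = {(x, y)\<in>R. real (card (R `` {x})) < t}"
  define L' where "L' = {(x, y)\<in>R. real (card (R\<inverse> `` {y})) < t}"
  have "L' = prod.swap ` {(y, x)\<in>R\<inverse>. real (card (R\<inverse> `` {y})) < t}"
    by (auto simp: L'_def image_iff)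
  then have "card L' = card {(y, x)\<in>R\<inverse>. real (card (R\<inverse> `` {y})) < t}"
    by (simp add: card_image)
  then have L': "real (card L') \<le> t * real (card (Range R))"
    using card_low_out_degree_edges[of "R\<inverse>" t] assms by simp
  have L: "real (card L) \<le> t * real (card (Domain R))"
    using card_low_out_degree_edges[of R t] assms by (simp add: L_def)
  have fL: "finite L" "finite L'" "L \<union> L' \<subseteq> R"
    using assms(1) by (auto simp: L_def L'_def intro: finite_subset)
  have "card R = card (R - (L \<union> L')) + card (L \<union> L')"
    using assms(1) fL card_Diff_subset[of "L \<union> L'" R] card_mono[of R "L \<union> L'"] by simp
  then have "real (card R) \<le> real (card (R - (L \<union> L'))) + real (card L) + real (card L')"
    using card_Un_le[of L L'] by linarith
  then have "(t - 1)\<^sup>2 * (real (card R) - t * (real (card (Domain R)) + real (card (Range R))))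
      \<le> (t - 1)\<^sup>2 * real (card (R - (L \<union> L')))"
    using L L' by (intro mult_left_mono) (auto simp: distrib_left)
  also have "\<dots> = (\<Sum>p\<in>R - (L \<union> L'). (t - 1)\<^sup>2)" by (simp add: mult.commute)
  also have "\<dots> \<le> (\<Sum>(x, y)\<in>R - (L \<union> L'). real ((card (R\<inverse> `` {y}) - 1) * (card (R `` {x}) - 1)))"
  proof (rule sum_mono)
    fix p assume p: "p \<in> R - (L \<union> L')"
    obtain x y where [simp]: "p = (x, y)" by fastforce
    have "t - 1 \<le> real (card (R\<inverse> `` {y}) - 1)" "t - 1 \<le> real (card (R `` {x}) - 1)"
      using p by (auto simp: L_def L'_def)
    then have "(t - 1)\<^sup>2 \<le> real ((card (R\<inverse> `` {y}) - 1) * (card (R `` {x}) - 1))"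
      unfolding power2_eq_square of_nat_mult using assms(2) by (intro mult_mono) auto
    then show "(t - 1)\<^sup>2 \<le> (case p of (x, y) \<Rightarrow> real ((card (R\<inverse> `` {y}) - 1) * (card (R `` {x}) - 1)))"
      by simp
  qed
  also have "\<dots> \<le> (\<Sum>(x, y)\<in>R. real ((card (R\<inverse> `` {y}) - 1) * (card (R `` {x}) - 1)))"
    using assms(1) by (intro sum_mono2) auto
  also have "\<dots> = real (\<Sum>(x, y)\<in>Domain R \<times> Range R. card (path_middles R x y))"
    unfolding sum_path_middles[OF assms(1)] by (simp add: case_prod_unfold)
  finally show ?thesis .
qed

section \<open>Closed walks of length four\<close>

text \<open>Cauchy-Schwarz twice: over \<open>y\<close>, which produces weighted codegrees of pairs
  \<open>(x, x')\<close>, and then over these pairs, which squares the codegrees. The summation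
  order on the right puts \<open>x\<close> and \<open>y\<close> outermost, so that for an indicator
  \<open>w\<close> the inner sums count the walks closed by the edge \<open>(x, y)\<close>.\<close>

lemma sidorenko_C4:
  fixes w :: "'x \<Rightarrow> 'y \<Rightarrow> real"
  shows "(\<Sum>x\<in>P. \<Sum>y\<in>Q. w x y) ^ 4 \<le> (real (card P) * real (card Q))\<^sup>2 *
    (\<Sum>x\<in>P. \<Sum>y\<in>Q. \<Sum>x'\<in>P. \<Sum>y'\<in>Q. w x y * w x' y' * (w x y' * w x' y))"
proof -
  let ?S = "\<Sum>x\<in>P. \<Sum>y\<in>Q. w x y"
  let ?T = "\<Sum>y\<in>Q. (\<Sum>x\<in>P. w x y)\<^sup>2"
  let ?C = "\<lambda>p. \<Sum>y\<in>Q. w (fst p) y * w (snd p) y"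
  have "?S\<^sup>2 = (\<Sum>y\<in>Q. \<Sum>x\<in>P. w x y)\<^sup>2"
    by (simp only: sum.swap[of w Q P])
  also have "\<dots> \<le> real (card Q) * ?T"
    by (subst mult.commute) (rule sum_squared_le_sum_of_squares)
  finally have 1: "?S\<^sup>2 \<le> real (card Q) * ?T" .
  have "?T = (\<Sum>y\<in>Q. \<Sum>x\<in>P. \<Sum>x'\<in>P. w x y * w x' y)"
    by (simp add: power2_eq_square sum_product)
  also have "\<dots> = (\<Sum>x\<in>P. \<Sum>y\<in>Q. \<Sum>x'\<in>P. w x y * w x' y)"
    by (rule sum.swap)
  also have "\<dots> = (\<Sum>x\<in>P. \<Sum>x'\<in>P. \<Sum>y\<in>Q. w x y * w x' y)"
    by (rule sum.cong[OF refl]) (rule sum.swap)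
  also have "\<dots> = (\<Sum>p\<in>P \<times> P. ?C p)"
    by (subst sum.cartesian_product) (simp add: case_prod_unfold)
  finally have T: "?T = (\<Sum>p\<in>P \<times> P. ?C p)" .
  have "?T\<^sup>2 \<le> real (card (P \<times> P)) * (\<Sum>p\<in>P \<times> P. (?C p)\<^sup>2)"
    unfolding T by (subst mult.commute) (rule sum_squared_le_sum_of_squares)
  also have "(\<Sum>p\<in>P \<times> P. (?C p)\<^sup>2) =
      (\<Sum>x\<in>P. \<Sum>x'\<in>P. \<Sum>y\<in>Q. \<Sum>y'\<in>Q. w x y * w x' y * (w x y' * w x' y'))"
    by (subst sum.cartesian_product) (simp add: power2_eq_square sum_product case_prod_unfold)
  also have "\<dots> = (\<Sum>x\<in>P. \<Sum>y\<in>Q. \<Sum>x'\<in>P. \<Sum>y'\<in>Q. w x y * w x' y * (w x y' * w x' y'))"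
    by (rule sum.cong[OF refl]) (rule sum.swap)
  finally have 2: "?T\<^sup>2 \<le> (real (card P))\<^sup>2 *
      (\<Sum>x\<in>P. \<Sum>y\<in>Q. \<Sum>x'\<in>P. \<Sum>y'\<in>Q. w x y * w x' y' * (w x y' * w x' y))"
    by (simp add: card_cartesian_product power2_eq_square mult_ac)
  have "?S ^ 4 = (?S\<^sup>2)\<^sup>2" by simp
  also have "\<dots> \<le> (real (card Q) * ?T)\<^sup>2"
    using 1 by (intro power_mono) auto
  also have "\<dots> = (real (card Q))\<^sup>2 * ?T\<^sup>2" by (simp add: power_mult_distrib)
  also have "\<dots> \<le> (real (card Q))\<^sup>2 * ((real (card P))\<^sup>2 *
      (\<Sum>x\<in>P. \<Sum>y\<in>Q. \<Sum>x'\<in>P. \<Sum>y'\<in>Q. w x y * w x' y' * (w x y' * w x' y)))"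
    by (intro mult_left_mono 2) auto
  finally show ?thesis by (simp add: power_mult_distrib mult_ac)
qed

text \<open>Apply the preceding inequality to the indicator of \<open>R\<close>. The walks closed by
  a fixed edge are its genuine paths of length three and the degenerate walks, at most
  \<open>2 * m\<close> in number by the degree bounds.\<close>

lemma card_pow4_le_path_middles:
  assumes fin: "finite R" and deg: "\<And>x. card (R `` {x}) \<le> m" "\<And>y. card (R\<inverse> `` {y}) \<le> m"
  shows "real (card R) ^ 4 \<le> (real (card (Domain R)) * real (card (Range R)))\<^sup>2 *
    (real (\<Sum>(x, y)\<in>R. card (path_middles R x y)) + 2 * real m * real (card R))"
proof -
  let ?P = "Domain R" and ?Q = "Range R"
  define w :: "'a \<Rightarrow> 'b \<Rightarrow> real" where "w x y = of_bool ((x, y) \<in> R)" for x y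
  \<comment> \<open>Like \<open>path_middles\<close>, but with \<open>x' = x\<close> and
    \<open>y' = y\<close> allowed.\<close>
  define Z where "Z x y = {(x', y')\<in>R. (x, y') \<in> R \<and> (x', y) \<in> R}" for x y
  have finPQ: "finite (?P \<times> ?Q)" using fin by (simp add: finite_Domain finite_Range)
  have sub: "R \<subseteq> ?P \<times> ?Q" by auto
  have "(\<Sum>x\<in>?P. \<Sum>y\<in>?Q. w x y) = (\<Sum>p\<in>?P \<times> ?Q. of_bool (p \<in> R))"
    by (simp add: w_def sum.cartesian_product case_prod_unfold)
  also have "\<dots> = real (card R)"
    using finPQ sub by (simp add: of_bool_def sum.If_cases Int_absorb1)
  finally have S: "(\<Sum>x\<in>?P. \<Sum>y\<in>?Q. w x y) = real (card R)" .
  have Z: "(\<Sum>x'\<in>?P. \<Sum>y'\<in>?Q. w x' y' * (w x y' * w x' y)) = real (card (Z x y))" for x y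
  proof -
    have "(\<Sum>x'\<in>?P. \<Sum>y'\<in>?Q. w x' y' * (w x y' * w x' y)) =
        (\<Sum>p\<in>?P \<times> ?Q. of_bool (p \<in> Z x y))"
      by (auto simp: w_def Z_def sum.cartesian_product intro!: sum.cong)
    moreover have "Z x y \<subseteq> ?P \<times> ?Q" by (auto simp: Z_def)
    ultimately show ?thesis
      using finPQ by (simp add: of_bool_def sum.If_cases Int_absorb1)
  qed
  have "(\<Sum>x\<in>?P. \<Sum>y\<in>?Q. \<Sum>x'\<in>?P. \<Sum>y'\<in>?Q. w x y * w x' y' * (w x y' * w x' y)) =
      (\<Sum>x\<in>?P. \<Sum>y\<in>?Q. w x y * real (card (Z x y)))"
    by (simp add: Z[symmetric] sum_distrib_left mult.assoc)
  also have "\<dots> = (\<Sum>p\<in>?P \<times> ?Q. if p \<in> R then real (card (Z (fst p) (snd p))) else 0)"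
    by (auto simp: w_def sum.cartesian_product intro!: sum.cong)
  also have "\<dots> = (\<Sum>p\<in>R. real (card (Z (fst p) (snd p))))"
    using finPQ sub by (simp add: sum.If_cases Int_absorb1)
  also have "\<dots> \<le> (\<Sum>p\<in>R. real (card (path_middles R (fst p) (snd p))) + 2 * real m)"
  proof (rule sum_mono)
    fix p assume "p \<in> R"
    obtain x y where [simp]: "p = (x, y)" by fastforce
    have fin': "finite (path_middles R x y)" "finite (R `` {x})" "finite (R\<inverse> `` {y})"
      using fin by (auto simp: path_middles_def intro: finite_Image elim: finite_subset[rotated])
    \<comment> \<open>If \<open>x' = x\<close>, only \<open>y'\<close> is free, among the neighbours
      of \<open>x\<close>; symmetrically if \<open>y' = y\<close>.\<close>
    have "Z x y \<subseteq> path_middles R x y \<union> ({x} \<times> R `` {x} \<union> R\<inverse> `` {y} \<times> {y})"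
      by (auto simp: Z_def path_middles_def)
    then have "card (Z x y) \<le> card (path_middles R x y \<union> ({x} \<times> R `` {x} \<union> R\<inverse> `` {y} \<times> {y}))"
      by (rule card_mono[rotated]) (use fin' in simp)
    also have "\<dots> \<le> card (path_middles R x y) + (card ({x} \<times> R `` {x}) + card (R\<inverse> `` {y} \<times> {y}))"
      by (meson add_le_mono card_Un_le le_refl le_trans)
    also have "\<dots> \<le> card (path_middles R x y) + (m + m)"
      using deg(1)[of x] deg(2)[of y] by (simp add: card_cartesian_product del: Image_singleton_iff)
    finally show "real (card (Z (fst p) (snd p))) \<le> real (card (path_middles R (fst p) (snd p))) + 2 * real m"
      by simp
  qed
  also have "\<dots> = real (\<Sum>(x, y)\<in>R. card (path_middles R x y)) + 2 * real m * real (card R)"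
    by (simp add: sum.distrib case_prod_unfold mult.commute)
  finally show ?thesis
    using sidorenko_C4[where w = w and P = ?P and Q = ?Q]
    by (auto simp: S elim!: order_trans intro!: mult_left_mono)
qed

section \<open>Splitting the given graph and deriving the two bounds\<close>

theorem theorem32:
  fixes f :: "real \<Rightarrow> real"
    and A B :: "'a set" and E :: "'a set set"
    and n :: nat and d :: real
  assumes "\<And>x. 0 \<le> f x"
    and "mono f"
    and "finite_simple_graph (A \<union> B) E"
    and "bipartition A B E"
    and "n = card (A \<union> B)"
    and "d = average_degree (A \<union> B) E"
    and "d \<ge> 16"
  shows "((\<forall>u\<in>A \<union> B. \<forall>v\<in>A \<union> B. u \<noteq> v \<longrightarrow> sparse_sub_bineighborhoods f E u v) \<longrightarrow>
           d ^ 3 \<le> 2 ^ 11 * real n * f (2 * d))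
       \<and> ((\<forall>u\<in>A \<union> B. \<forall>v\<in>A \<union> B. {u, v} \<in> E \<longrightarrow> sparse_sub_bineighborhoods f E u v) \<and>
           real (card E) \<ge> 25 * real n powr (3 / 2) \<longrightarrow>
           d ^ 3 \<le> 2 ^ 20 * real n * f (2 * d))"
proof -
  have finAB: "finite A" "finite B" and disj: "A \<inter> B = {}"
    and Eb: "\<And>e. e \<in> E \<Longrightarrow> \<exists>a\<in>A. \<exists>b\<in>B. e = {a, b}"
    using assms(3,4) by (auto simp: finite_simple_graph_def bipartition_def)
  \<comment> \<open>The edges are oriented from \<open>A\<close> to \<open>B\<close>, so that the
    relational lemmas apply.\<close>
  define X where "X = {(a, b). a \<in> A \<and> b \<in> B \<and> {a, b} \<in> E}"
  have XAB: "X \<subseteq> A \<times> B" by (auto simp: X_def)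
  then have finX: "finite X" using finAB by (meson finite_SigmaI finite_subset)
  have "bij_betw (\<lambda>(a, b). {a, b}) X E"
    unfolding bij_betw_def
  proof
    show "inj_on (\<lambda>(a, b). {a, b}) X"
      using disj by (auto simp: inj_on_def X_def doubleton_eq_iff)
    show "(\<lambda>(a, b). {a, b}) ` X = E"
      using Eb by (fastforce simp: X_def)
  qed
  then have cardX: "card X = card E" by (rule bij_betw_same_card)
  \<comment> \<open>For \<open>n = 0\<close> division by zero would give \<open>d = 0\<close>,
    against \<open>d \<ge> 16\<close>.\<close>
  have "real n > 0"
    using assms(5-7) by (cases "n = 0") (auto simp: average_degree_def)
  have e: "real (card E) = real n * d / 2"
    using \<open>real n > 0\<close> assms(5,6) by (simp add: average_degree_def)
  define m where "m = nat \<lfloor>d\<rfloor>"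
  have m: "real m \<le> d" "d < real m + 1" "m \<ge> 16"
    using assms(7) unfolding m_def by linarith+
  then obtain R :: "(('a \<times> nat) \<times> ('a \<times> nat)) set" where
    bij: "bij_betw (map_prod fst fst) R X" and
    deg: "\<And>x. card (R `` {x}) \<le> m" "\<And>y. card (R\<inverse> `` {y}) \<le> m" and
    dom: "m * card (Domain R) \<le> m * card (Domain X) + card X" and
    ran: "m * card (Range R) \<le> m * card (Range X) + card X"
    using vertex_splitting[OF finX, of m] by auto
  have finR: "finite R" using bij finX bij_betw_finite by blast
  have cardR: "real (card R) = real n * d / 2"
    using bij_betw_same_card[OF bij] cardX e by simp
  have edges: "fst x \<in> A \<and> fst y \<in> B \<and> {fst x, fst y} \<in> E" if "(x, y) \<in> R" for x y
    using bij_betwE[OF bij] that by (force simp: X_def)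
  define p q where "p = real (card (Domain R))" and "q = real (card (Range R))"
  have pq: "p \<ge> 0" "q \<ge> 0" by (auto simp: p_def q_def)
  have "card (Domain X) + card (Range X) \<le> card A + card B"
    using XAB finAB by (intro add_mono card_mono) auto
  then have "card (Domain X) + card (Range X) \<le> n"
    using assms(5) card_Un_disjoint[OF finAB disj] by simp
  then have "m * (card (Domain X) + card (Range X)) \<le> m * n" by (rule mult_le_mono2)
  then have "m * card (Domain R) + m * card (Range R) \<le> m * n + 2 * card X"
    using dom ran by (simp add: distrib_left)
  then have "real (m * card (Domain R) + m * card (Range R)) \<le> real (m * n + 2 * card X)"
    by (rule of_nat_mono)
  then have "real m * (p + q) \<le> real m * real n + real n * d"
    using e by (simp add: p_def q_def distrib_left cardX)
  \<comment> \<open>Since \<open>m \<ge> 16\<close>, \<open>d < m + 1 \<le> 17 / 16 * m\<close>.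
    Hence the number \<open>p + q\<close> of copies is at most \<open>1 + 17 / 16 = 33 / 16\<close>
    times \<open>n\<close>.\<close>
  also have "\<dots> \<le> real m * real n + real n * (17 / 16 * real m)"
    using m by (intro add_left_mono mult_left_mono) auto
  also have "\<dots> = real m * (33 / 16 * real n)" by simp
  finally have N: "p + q \<le> 33 / 16 * real n" using m by simp
  \<comment> \<open>The arithmetic-geometric mean inequality; the constant below is
    \<open>(33 / 16)\<^sup>2 / 4\<close>.\<close>
  have "4 * (p * q) \<le> (p + q)\<^sup>2"
    using sum_squares_ge_zero[of "p - q" 0] by (simp add: power2_eq_square algebra_simps)
  also have "\<dots> \<le> (33 / 16 * real n)\<^sup>2"
    using N pq by (intro power_mono) auto
  finally have PQ: "p * q \<le> 1089 / 1024 * (real n)\<^sup>2" by (simp add: power2_eq_square)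
  let ?F = "f (2 * d)"
  have F: "?F \<ge> 0" by (rule assms(1))
  have mid: "real (card (path_middles R x y)) \<le> ?F"
    if "sparse_sub_bineighborhoods f E (fst x) (fst y)" for x y
    using path_middles_le_sparse[OF assms(2) disj bij_betw_imp_inj_on[OF bij] edges finR deg that m(1)] .
  show ?thesis
  proof (intro conjI impI)
    assume sp: "\<forall>u\<in>A \<union> B. \<forall>v\<in>A \<union> B. u \<noteq> v \<longrightarrow> sparse_sub_bineighborhoods f E u v"
    \<comment> \<open>In (i) every pair of copies from opposite sides has distinct originals, so
      each pair carries at most \<open>?F\<close> paths.\<close>
    have "real (\<Sum>(x, y)\<in>Domain R \<times> Range R. card (path_middles R x y)) \<le>
        (\<Sum>z\<in>Domain R \<times> Range R. ?F)"
      unfolding of_nat_sum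
    proof (rule sum_mono, clarify)
      fix x y z z' assume "(x, z) \<in> R" "(z', y) \<in> R"
      then have "fst x \<in> A" "fst y \<in> B" using edges by auto
      moreover from this have "fst x \<noteq> fst y" using disj by auto
      ultimately show "real (card (path_middles R x y)) \<le> ?F"
        using sp by (intro mid) auto
    qed
    also have "\<dots> = p * q * ?F" by (simp add: p_def q_def card_cartesian_product)
    also have "\<dots> \<le> 1089 / 1024 * (real n)\<^sup>2 * ?F" using PQ F by (rule mult_right_mono)
    finally have up: "real (\<Sum>(x, y)\<in>Domain R \<times> Range R. card (path_middles R x y)) \<le> \<dots>" .
    \<comment> \<open>The threshold is \<open>t = d / 8\<close>. Then
      \<open>t - 1 \<ge> d / 16\<close> because \<open>d \<ge> 16\<close>, and of the
      \<open>n * d / 2\<close> edges at most \<open>33 / 128 * n * d\<close> are discarded.\<close>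
    have "(d / 16)\<^sup>2 * (31 / 128 * (real n * d)) \<le>
        (d / 8 - 1)\<^sup>2 * (real (card R) - d / 8 * (p + q))"
    proof (rule mult_mono)
      show "(d / 16)\<^sup>2 \<le> (d / 8 - 1)\<^sup>2" using assms(7) by (intro power_mono) auto
      have "d / 8 * (p + q) \<le> d / 8 * (33 / 16 * real n)"
        using N assms(7) by (intro mult_left_mono) auto
      then show "31 / 128 * (real n * d) \<le> real (card R) - d / 8 * (p + q)"
        by (simp add: cardR)
    qed (use assms(7) in auto)
    also have "\<dots> \<le> real (\<Sum>(x, y)\<in>Domain R \<times> Range R. card (path_middles R x y))"
      unfolding p_def q_def by (rule sum_path_middles_ge[OF finR]) (use assms(7) in simp)
    also note up
    finally have "real n * (31 / 32768 * d ^ 3) \<le> real n * (1089 / 1024 * real n * ?F)"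
      by (simp add: power2_eq_square power3_eq_cube mult_ac)
    then have "31 / 32768 * d ^ 3 \<le> 1089 / 1024 * (real n * ?F)"
      using \<open>real n > 0\<close> by simp
    moreover have "real n * ?F \<ge> 0" using F by simp
    \<comment> \<open>The constant obtained is \<open>1089 * 32 / 31\<close>, about 1124.\<close>
    ultimately show "d ^ 3 \<le> 2 ^ 11 * real n * ?F" by simp
  next
    assume sp: "(\<forall>u\<in>A \<union> B. \<forall>v\<in>A \<union> B. {u, v} \<in> E \<longrightarrow> sparse_sub_bineighborhoods f E u v) \<and>
           real (card E) \<ge> 25 * real n powr (3 / 2)"
    \<comment> \<open>The lower bound on the number of edges amounts to
      \<open>d \<ge> 50 * sqrt n\<close>; it is what makes the degenerate walks negligible.\<close>
    have "real n powr (3 / 2) = real n powr (1 + 1 / 2)" by simp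
    also have "\<dots> = real n * sqrt (real n)"
      using \<open>real n > 0\<close> by (subst powr_add) (simp add: powr_half_sqrt)
    finally have "real n * (50 * sqrt (real n)) \<le> real n * d" using sp e by simp
    then have "50 * sqrt (real n) \<le> d" using \<open>real n > 0\<close> by simp
    then have "(50 * sqrt (real n))\<^sup>2 \<le> d\<^sup>2" by (intro power_mono) auto
    then have dn: "2500 * real n \<le> d\<^sup>2" by (simp add: power_mult_distrib)
    \<comment> \<open>Edges of \<open>R\<close> project to edges of the original graph, so sparsity
      for adjacent pairs suffices here.\<close>
    have "real (\<Sum>(x, y)\<in>R. card (path_middles R x y)) \<le> (\<Sum>z\<in>R. ?F)"
      unfolding of_nat_sum
    proof (rule sum_mono, clarify)
      fix x k y l assume "((x, k), (y, l)) \<in> R"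
      then show "real (card (path_middles R (x, k) (y, l))) \<le> ?F"
        using sp edges by (intro mid) fastforce
    qed
    also have "\<dots> = real n * d / 2 * ?F" by (simp add: cardR)
    finally have up: "real (\<Sum>(x, y)\<in>R. card (path_middles R x y)) \<le> \<dots>" .
    have "2 * real m * real (card R) = real n * d * real m" by (simp add: cardR)
    also have "\<dots> \<le> real n * d * d"
      using m(1) assms(7) by (intro mult_left_mono) auto
    also have "\<dots> = real n * d\<^sup>2" by (simp add: power2_eq_square)
    also have "\<dots> \<le> d\<^sup>2 / 2500 * d\<^sup>2"
      using dn by (intro mult_right_mono) auto
    finally have deg_le: "2 * real m * real (card R) \<le> d ^ 4 / 2500"
      by (simp add: power2_eq_square power4_eq_xxxx)
    have "(real n * d / 2) ^ 4 \<le> (p * q)\<^sup>2 *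
        (real (\<Sum>(x, y)\<in>R. card (path_middles R x y)) + 2 * real m * real (card R))"
      using card_pow4_le_path_middles[OF finR deg] by (simp add: cardR p_def q_def)
    also have "\<dots> \<le> (1089 / 1024 * (real n)\<^sup>2)\<^sup>2 * (real n * d / 2 * ?F + d ^ 4 / 2500)"
    proof (rule mult_mono)
      show "(p * q)\<^sup>2 \<le> (1089 / 1024 * (real n)\<^sup>2)\<^sup>2"
        using PQ pq by (intro power_mono) auto
    qed (use up deg_le in \<open>auto simp: sum_nonneg\<close>)
    \<comment> \<open>\<open>(1089 / 1024)\<^sup>2\<close> is rounded up to 2.\<close>
    also have "\<dots> \<le> (2 * real n ^ 4) * (real n * d / 2 * ?F + d ^ 4 / 2500)"
      using assms(7) F by (intro mult_right_mono add_nonneg_nonneg)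
        (auto simp: power_mult_distrib power_divide)
    also have "\<dots> = real n ^ 4 * (real n * d * ?F + d ^ 4 / 1250)"
      by (simp add: distrib_left)
    finally have "real n ^ 4 * (d ^ 4 / 16) \<le> \<dots>"
      by (simp add: power_mult_distrib power_divide)
    then have "d ^ 4 / 16 \<le> real n * d * ?F + d ^ 4 / 1250"
      using \<open>real n > 0\<close> by simp
    \<comment> \<open>The degenerate share \<open>d ^ 4 / 1250\<close> is absorbed by the main term
      \<open>d ^ 4 / 16\<close>. Cancelling \<open>d\<close> leaves the claim with a constant below
      17.\<close>
    then have "d * (d ^ 3 * (1 / 16 - 1 / 1250)) \<le> d * (real n * ?F)"
      by (simp add: power4_eq_xxxx power3_eq_cube algebra_simps)
    then have "d ^ 3 * (1 / 16 - 1 / 1250) \<le> real n * ?F"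
      using assms(7) by simp
    moreover have "real n * ?F \<ge> 0" using F by simp
    ultimately show "d ^ 3 \<le> 2 ^ 20 * real n * ?F" by simp
  qed
qed

end
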